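(* Let $C_n$ denote the number of key comparisons performed by the dual-pivot quicksort algorithm ``Count'' (described in the context) on a uniformly random input of $n$ distinct elements. For $n\ge 4$, \[ \mathbb{E}[C_n] = \frac95 nH_n - \frac15 nH^{\mathrm{alt}}_n - \frac{89}{25}n + \frac{67}{40}H_n - \frac{3}{40}H^{\mathrm{alt}}_n - \frac{83}{800} + \frac{(-1)^n}{10} - \frac{[n\text{ even}]}{320}\Bigl(\frac1{n-3}+\frac3{n-1}\Bigr) + \frac{[n\text{ odd}]}{320}\Bigl(\frac3{n-2}+\frac1n\Bigr). \]
   Context: $H_n=\sum_{m=1}^n \frac1m$ and $H^{\mathrm{alt}}_n=\sum_{m=1}^n\frac{(-1)^m}{m}$. Iverson bracket: $[P]=1$ if $P$ is true and $0$ otherwise. Dual-pivot quicksort ``Count'': the input is a sequence $(a_1,\dots,a_n)$ of $n$ distinct elements in uniformly random order (each of the $n!$ orderings equally likely). If $n\le 1$ nothing is done. Otherwise $a_1$ and $a_n$ are compared once, giving pivots $p=\min(a_1,a_n)$ and $q=\max(a_1,a_n)$. Then $a_2,\dots,a_{n-1}$ are classified one after another, in this order, as small ($<p$), medium (between $p$ and $q$) or large ($>q$): each element is first compared with one pivot, and, if this comparison does not determine its class, also with the other pivot. Strategy ``Count'': when classifying the $(t+1)$-st element ($0\le t<n-2$), let $s_t$ and $\ell_t$ be the numbers of elements classified as small resp. large among the first $t$ classified elements; if $s_t\ge\ell_t$, compare with $p$ first, otherwise with $q$ first. Afterwards the algorithm is applied recursively to the small, the medium and the large elements. $C_n$ is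 the total number of key comparisons. *)

theory Defs
  imports "HOL-Probability.Probability" "HOL-Combinatorics.Multiset_Permutations"
begin

text \<open>
  Number of key comparisons made when the given elements are classified one after another
  with respect to the pivots \<open>p < q\<close> by strategy ``Count''. The arguments \<open>s\<close> and \<open>l\<close> are the
  numbers of elements classified so far as small and large. An element costs 2 unless it
  is small and compared with \<open>p\<close> first, or large and compared with \<open>q\<close> first.
\<close>

fun classify_comparisons :: "'a::linorder \<Rightarrow> 'a \<Rightarrow> nat \<Rightarrow> nat \<Rightarrow> 'a list \<Rightarrow> nat" where
  "classify_comparisons p q s l [] = 0"
| "classify_comparisons p q s l (x # xs) =
     (if s \<ge> l then (if x < p then 1 else 2) else (if x > q then 1 else 2)) +
     classify_comparisons p q
       (if x < p then s + 1 else s) (if x > q then l + 1 else l) xs"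

text \<open>
  The sublists handed to the recursive calls keep the relative order of the input, so that
  each of them is again uniformly ordered.
\<close>

function count_comparisons :: "'a::linorder list \<Rightarrow> nat" where
  "count_comparisons xs =
     (if length xs \<le> 1 then 0
      else
        let p = min (hd xs) (last xs);
            q = max (hd xs) (last xs);
            ys = butlast (tl xs)
        in 1 + classify_comparisons p q 0 0 ys
             + count_comparisons (filter (\<lambda>x. x < p) ys)
             + count_comparisons (filter (\<lambda>x. p < x \<and> x < q) ys)
             + count_comparisons (filter (\<lambda>x. x > q) ys))"
  by pat_completeness auto
termination
proof (relation "Wellfounded.measure length", goal_cases)
  case 1
  show ?case by simp
qed (auto intro!: le_less_trans[OF length_filter_le])

declare count_comparisons.simps [simp del]

definition alt_harm :: "nat \<Rightarrow> real" where
  "alt_harm n = (\<Sum>m = 1..n. (-1) ^ m / real m)"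

end

theory Submission
  imports Defs "HOL-Probability.Random_Permutations"
begin

text \<open>
  Deleting the element classified last from a random permutation of \<open>n + 1\<close> elements leaves a
  random permutation of \<open>n\<close> elements, and the cost of classifying that last element depends
  only on the ranks of the pivots and on its own class. Hence the expected partitioning
  cost grows by an explicit amount from \<open>n\<close> to \<open>n + 1\<close>. Filtering a random permutation gives
  a random permutation again, so the expected total cost satisfies the recurrence
  \<open>e(n) = p(n) + 6/(n(n - 1)) (\<Sum>k \<le> n - 2. (n - 1 - k) e(k))\<close>, where \<open>p(n)\<close> is the expected
  partitioning cost. Multiplied by \<open>n(n - 1)\<close> and differenced twice, it becomes a relation
  between \<open>e(n)\<close>, \<open>e(n + 1)\<close> and \<open>e(n + 2)\<close>, which the closed form satisfies.
\<close>

section \<open>Sums over permutations and random sublists\<close>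

lemma sum_permutations_of_set_Cons:
  fixes f :: "'a list \<Rightarrow> 'b::comm_monoid_add"
  assumes "finite A" "A \<noteq> {}"
  shows "(\<Sum>xs\<in>permutations_of_set A. f xs) = (\<Sum>x\<in>A. \<Sum>xs\<in>permutations_of_set (A - {x}). f (x # xs))"
proof -
  have "(\<Sum>xs\<in>permutations_of_set A. f xs) =
      (\<Sum>x\<in>A. \<Sum>xs\<in>(#) x ` permutations_of_set (A - {x}). f xs)"
    unfolding permutations_of_set_nonempty[OF assms(2)]
    by (rule sum.UNION_disjoint) (use assms in auto)
  also have "\<dots> = (\<Sum>x\<in>A. \<Sum>xs\<in>permutations_of_set (A - {x}). f (x # xs))"
    by (simp add: sum.reindex)
  finally show ?thesis .
qed

lemma sum_permutations_of_set_rev: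
  fixes f :: "'a list \<Rightarrow> 'b::comm_monoid_add"
  shows "(\<Sum>xs\<in>permutations_of_set A. f (rev xs)) = (\<Sum>xs\<in>permutations_of_set A. f xs)"
  using sum.reindex[of rev "permutations_of_set A" f] by simp

text \<open>Reversal permutes the permutations, so the last element splits off like the first. This
  serves for the second pivot and for the element classified last.\<close>

lemma sum_permutations_of_set_snoc:
  fixes f :: "'a list \<Rightarrow> 'b::comm_monoid_add"
  assumes "finite A" "A \<noteq> {}"
  shows "(\<Sum>xs\<in>permutations_of_set A. f xs) = (\<Sum>x\<in>A. \<Sum>xs\<in>permutations_of_set (A - {x}). f (xs @ [x]))"
proof -
  have "(\<Sum>xs\<in>permutations_of_set A. f xs) = (\<Sum>xs\<in>permutations_of_set A. f (rev xs))"
    by (rule sum_permutations_of_set_rev [symmetric])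
  also have "\<dots> = (\<Sum>x\<in>A. \<Sum>xs\<in>permutations_of_set (A - {x}). f (rev xs @ [x]))"
    by (subst sum_permutations_of_set_Cons[OF assms]) simp
  also have "\<dots> = (\<Sum>x\<in>A. \<Sum>xs\<in>permutations_of_set (A - {x}). f (xs @ [x]))"
    by (intro sum.cong refl sum_permutations_of_set_rev[of "\<lambda>xs. f (xs @ [_])"])
  finally show ?thesis .
qed

text \<open>\<open>filter P\<close> is the first component of \<open>partition P\<close>, which
  turns a random permutation into an independent pair of random permutations.\<close>

lemma map_pmf_filter_random_permutation:
  assumes "finite A"
  shows "map_pmf (filter P) (pmf_of_set (permutations_of_set A)) = pmf_of_set (permutations_of_set {x\<in>A. P x})"
proof -
  have "map_pmf (filter P) (pmf_of_set (permutations_of_set A)) =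
      map_pmf fst (map_pmf (partition P) (pmf_of_set (permutations_of_set A)))"
    by (simp add: pmf.map_comp o_def)
  also have "\<dots> = pmf_of_set (permutations_of_set {x\<in>A. P x})"
    by (simp add: partition_random_permutations[OF assms] map_fst_pair_pmf)
  finally show ?thesis .
qed

lemma expectation_permutations_of_set:
  fixes f :: "'a list \<Rightarrow> real"
  assumes "finite A"
  shows "measure_pmf.expectation (pmf_of_set (permutations_of_set A)) f =
    (\<Sum>xs\<in>permutations_of_set A. f xs) / fact (card A)"
  by (subst integral_pmf_of_set) (use assms in auto)

lemma sum_permutations_of_set_filter:
  fixes f :: "'a list \<Rightarrow> real"
  assumes "finite A"
  shows "(\<Sum>xs\<in>permutations_of_set A. f (filter P xs)) = fact (card A) *
    measure_pmf.expectation (pmf_of_set (permutations_of_set {x\<in>A. P x})) f"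
proof -
  have "measure_pmf.expectation (pmf_of_set (permutations_of_set {x\<in>A. P x})) f =
    measure_pmf.expectation (pmf_of_set (permutations_of_set A)) (\<lambda>xs. f (filter P xs))"
    unfolding map_pmf_filter_random_permutation[OF assms, symmetric] by simp
  thus ?thesis
    by (simp add: expectation_permutations_of_set[OF assms])
qed

section \<open>Sums over pairs of pivots, by rank\<close>

lemma sum_off_diagonal_swap:
  fixes f :: "'a \<Rightarrow> 'a \<Rightarrow> 'b::comm_monoid_add"
  assumes "finite A"
  shows "(\<Sum>a\<in>A. \<Sum>b\<in>A - {a}. f a b) = (\<Sum>b\<in>A. \<Sum>a\<in>A - {b}. f a b)"
proof -
  have "(\<Sum>a\<in>A. \<Sum>b\<in>A - {a}. f a b) = (\<Sum>a\<in>A. \<Sum>b\<in>{b\<in>A. a \<noteq> b}. f a b)"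
    by (intro sum.cong) auto
  also have "\<dots> = (\<Sum>b\<in>A. \<Sum>a\<in>{a\<in>A. a \<noteq> b}. f a b)"
    by (rule sum.swap_restrict) (use assms in auto)
  also have "\<dots> = (\<Sum>b\<in>A. \<Sum>a\<in>A - {b}. f a b)"
    by (intro sum.cong) auto
  finally show ?thesis .
qed

lemma sum_off_diagonal_min_max:
  fixes f :: "nat \<Rightarrow> nat \<Rightarrow> real"
  shows "(\<Sum>i<n. \<Sum>j\<in>{..<n} - {i}. f (min i j) (max i j)) = 2 * (\<Sum>j<n. \<Sum>i<j. f i j)"
proof (induction n)
  case (Suc n)
  have "(\<Sum>i<n. \<Sum>j\<in>{..<Suc n} - {i}. f (min i j) (max i j)) =
        (\<Sum>i<n. (\<Sum>j\<in>{..<n} - {i}. f (min i j) (max i j)) + f i n)"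
  proof (intro sum.cong refl)
    fix i assume i: "i \<in> {..<n}"
    hence *: "{..<Suc n} - {i} = insert n ({..<n} - {i})" by auto
    show "(\<Sum>j\<in>{..<Suc n} - {i}. f (min i j) (max i j)) =
        (\<Sum>j\<in>{..<n} - {i}. f (min i j) (max i j)) + f i n"
      unfolding * using i by (simp add: min_def max_def)
  qed
  moreover have "(\<Sum>j\<in>{..<Suc n} - {n}. f (min n j) (max n j)) = (\<Sum>i<n. f i n)"
    by (intro sum.cong) auto
  ultimately show ?case
    using Suc.IH by (simp add: sum.distrib)
qed simp

text \<open>Listing \<open>A\<close> in increasing order identifies it with the ranks
  \<open>{..<card A}\<close>. Pivots of ranks \<open>i < j\<close> have \<open>i\<close> elements
  below, \<open>j - Suc i\<close> between and \<open>card A - Suc j\<close> above, and each such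
  pair arises in both orders of \<open>a\<close> and \<open>b\<close>.\<close>

lemma sum_rank_pairs:
  fixes A :: "'a::linorder set" and f :: "nat \<Rightarrow> nat \<Rightarrow> nat \<Rightarrow> real"
  assumes "finite A"
  shows "(\<Sum>a\<in>A. \<Sum>b\<in>A - {a}. f (card {x\<in>A. x < min a b})
             (card {x\<in>A. min a b < x \<and> x < max a b}) (card {x\<in>A. max a b < x})) =
         2 * (\<Sum>j<card A. \<Sum>i<j. f i (j - Suc i) (card A - Suc j))"
proof -
  let ?n = "card A"
  define h where "h = (!) (sorted_list_of_set A)"
  have h: "bij_betw h {..<?n} A"
    unfolding h_def by (rule bij_betw_nth) (use assms in auto)
  have mono: "strict_mono_on {..<?n} h"
    unfolding h_def
    by (intro strict_mono_onI sorted_wrt_nth_less[OF strict_sorted_list_of_set]) auto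
  have less: "h i < h j \<longleftrightarrow> i < j" if "i < ?n" "j < ?n" for i j
    using strict_mono_on_less[OF mono] that by auto
  have inj: "inj_on h {..<?n}" using h by (rule bij_betw_imp_inj_on)
  have A: "A = h ` {..<?n}" using h by (simp add: bij_betw_def)
  have card_eq: "card {x\<in>A. P x} = card {i. i < ?n \<and> P (h i)}" for P
  proof -
    have "{x\<in>A. P x} = h ` {i. i < ?n \<and> P (h i)}" using A by auto
    thus ?thesis by (simp add: card_image inj_on_subset[OF inj] Collect_mono subset_iff)
  qed
  have ranks: "card {x\<in>A. x < h i} = i" "card {x\<in>A. h i < x \<and> x < h j} = j - Suc i"
    "card {x\<in>A. h j < x} = ?n - Suc j" if "i < ?n" "j < ?n" for i j
  proof -
    have "{k. k < ?n \<and> h k < h i} = {..<i}" "{k. k < ?n \<and> h i < h k \<and> h k < h j} = {Suc i..<j}"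
      "{k. k < ?n \<and> h j < h k} = {Suc j..<?n}"
      using less that by (auto simp: Suc_le_eq)
    thus "card {x\<in>A. x < h i} = i" "card {x\<in>A. h i < x \<and> x < h j} = j - Suc i"
      "card {x\<in>A. h j < x} = ?n - Suc j"
      by (simp_all add: card_eq)
  qed
  have minmax: "min (h i) (h j) = h (min i j)" "max (h i) (h j) = h (max i j)"
    if "i < ?n" "j < ?n" for i j
    using less[OF that] less[OF that(2,1)] by (auto simp: min_def max_def not_less le_less)
  let ?g = "\<lambda>a b. f (card {x\<in>A. x < min a b})
     (card {x\<in>A. min a b < x \<and> x < max a b}) (card {x\<in>A. max a b < x})"
  have "(\<Sum>a\<in>A. \<Sum>b\<in>A - {a}. ?g a b) = (\<Sum>i<?n. \<Sum>b\<in>A - {h i}. ?g (h i) b)"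
    by (rule sum.reindex_bij_betw[OF h, symmetric])
  also have "\<dots> = (\<Sum>i<?n. \<Sum>j\<in>{..<?n} - {i}. ?g (h i) (h j))"
  proof (intro sum.cong refl)
    fix i assume i: "i \<in> {..<?n}"
    have "bij_betw h ({..<?n} - {i}) (A - {h i})"
      using h i by (intro bij_betw_DiffI) (auto dest: bij_betwE)
    thus "(\<Sum>b\<in>A - {h i}. ?g (h i) b) = (\<Sum>j\<in>{..<?n} - {i}. ?g (h i) (h j))"
      by (rule sum.reindex_bij_betw[symmetric])
  qed
  also have "\<dots> = (\<Sum>i<?n. \<Sum>j\<in>{..<?n} - {i}.
      f (min i j) (max i j - Suc (min i j)) (?n - Suc (max i j)))"
    by (intro sum.cong refl) (auto simp: minmax ranks)
  also have "\<dots> = 2 * (\<Sum>j<card A. \<Sum>i<j. f i (j - Suc i) (card A - Suc j))"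
    by (rule sum_off_diagonal_min_max)
  finally show ?thesis .
qed

text \<open>Each \<open>i < n\<close> lies below exactly \<open>n - 1 - i\<close> of the
  \<open>j < n\<close>. With the next two lemmas, the sizes of the small, medium and large sublists
  all get the same weights.\<close>

lemma sum_triangle_lower:
  fixes f :: "nat \<Rightarrow> real"
  shows "(\<Sum>j<n. \<Sum>i<j. f i) = (\<Sum>i<n. (real n - 1 - real i) * f i)"
proof (induction n)
  case (Suc n)
  have "(\<Sum>i<Suc n. (real (Suc n) - 1 - real i) * f i) = (\<Sum>i<n. (real n - 1 - real i) * f i + f i)"
    by (simp add: algebra_simps)
  thus ?case using Suc.IH by (simp add: sum.distrib)
qed simp

lemma sum_triangle_gap:
  fixes f :: "nat \<Rightarrow> real"
  shows "(\<Sum>j<n. \<Sum>i<j. f (j - Suc i)) = (\<Sum>i<n. (real n - 1 - real i) * f i)"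
  by (simp add: sum.nat_diff_reindex sum_triangle_lower)

lemma sum_triangle_upper:
  fixes f :: "nat \<Rightarrow> real"
  shows "(\<Sum>j<n. \<Sum>i<j. f (n - Suc j)) = (\<Sum>i<n. (real n - 1 - real i) * f i)"
proof -
  have "(\<Sum>i<n. (real n - 1 - real i) * f i) = (\<Sum>i<n. (real n - 1 - real (n - Suc i)) * f (n - Suc i))"
    by (rule sum.nat_diff_reindex[symmetric])
  also have "\<dots> = (\<Sum>i<n. real i * f (n - Suc i))"
    by (intro sum.cong) (auto simp: of_nat_diff)
  finally show ?thesis by simp
qed

section \<open>The cost of the element classified last\<close>

lemma classify_comparisons_snoc:
  "classify_comparisons p q s l (ys @ [y]) = classify_comparisons p q s l ys +
     (if s + length (filter (\<lambda>x. x < p) ys) \<ge> l + length (filter (\<lambda>x. q < x) ys)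
      then (if y < p then 1 else 2) else (if y > q then 1 else 2))"
  by (induction ys arbitrary: s l) auto

text \<open>
  With \<open>i\<close> elements of the whole set below the smaller pivot and \<open>r\<close> above the larger one,
  \<open>savings i r\<close> is the number of elements that cost only one comparison when they are
  classified last: a small one sees the counts \<open>i - 1\<close> and \<open>r\<close>, a large one \<open>i\<close> and \<open>r - 1\<close>.
\<close>

definition savings :: "nat \<Rightarrow> nat \<Rightarrow> nat" where
  "savings i r = (if r < i then i else if i + 1 < r then r else 0)"

lemma length_filter_permutation:
  assumes "xs \<in> permutations_of_set A"
  shows "length (filter P xs) = card {x\<in>A. P x}"
proof -
  have "distinct xs" "set xs = A"
    using permutations_of_setD[OF assms] by auto
  thus ?thesis by (simp add: distinct_length_filter Int_def conj_commute)
qed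

text \<open>\<open>B\<close> stands for the elements classified before \<open>y\<close>. They matter
  only through their class counts, so a set can replace the list.\<close>

definition last_cost :: "'a::linorder set \<Rightarrow> 'a \<Rightarrow> 'a \<Rightarrow> 'a \<Rightarrow> nat" where
  "last_cost B p q y =
     (if card {x\<in>B. x < p} \<ge> card {x\<in>B. q < x}
      then (if y < p then 1 else 2) else (if y > q then 1 else 2))"

text \<open>Taking \<open>y\<close> out lowers only the count of its own class. A small
  \<open>y\<close> thus costs 1 iff \<open>i - 1 \<ge> r\<close>, a large one iff
  \<open>i < r - 1\<close>; these conditions exclude each other, and every other element costs
  2.\<close>

lemma sum_last_cost:
  fixes a b :: "'a::linorder"
  assumes "finite A" "a \<in> A" "b \<in> A" "a \<noteq> b"
  defines "p \<equiv> min a b" and "q \<equiv> max a b"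
  shows "(\<Sum>y\<in>A - {a} - {b}. real (last_cost (A - {a} - {b} - {y}) p q y)) =
    2 * (real (card A) - 2) - real (savings (card {x\<in>A. x < p}) (card {x\<in>A. q < x}))"
proof -
  define i where "i = card {x\<in>A. x < p}"
  define r where "r = card {x\<in>A. q < x}"
  let ?B = "A - {a} - {b}"
  have fin: "finite {x\<in>A. P x}" for P using assms(1) by simp
  have outer: "\<not> a < p" "\<not> b < p" "\<not> q < a" "\<not> q < b"
    by (simp_all add: p_def q_def)
  have cost: "real (last_cost (?B - {y}) p q y) =
     2 - (if y < p \<and> r < i then 1 else 0) - (if q < y \<and> i + 1 < r then 1 else 0)" if y: "y \<in> ?B" for y
  proof -
    have pq: "p < q" using assms(4) by (auto simp: p_def q_def min_def max_def)
    have "{x \<in> ?B - {y}. x < p} = {x\<in>A. x < p} - {y}" "{x \<in> ?B - {y}. q < x} = {x\<in>A. q < x} - {y}"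
      using outer by auto
    hence *: "card {x \<in> ?B - {y}. x < p} = i - (if y < p then 1 else 0)"
      "card {x \<in> ?B - {y}. q < x} = r - (if q < y then 1 else 0)"
      using y fin by (auto simp: i_def r_def card_Diff_singleton_if)
    \<comment> \<open>A count that is lowered by one is positive, so the truncated subtraction is
      exact.\<close>
    have "y < p \<Longrightarrow> i > 0" "q < y \<Longrightarrow> r > 0"
      using y fin by (auto simp: i_def r_def card_gt_0_iff)
    thus ?thesis using pq unfolding last_cost_def * by auto
  qed
  have "card ?B = card A - 2"
    using assms(1-4) by (simp add: card_Diff_singleton_if)
  moreover have "card A \<ge> 2"
    using card_mono[of A "{a,b}"] assms(1-4) by auto
  ultimately have card_B: "real (card ?B) = real (card A) - 2" by simp
  have "{y\<in>?B. y < p} = {y\<in>A. y < p}" "{y\<in>?B. q < y} = {y\<in>A. q < y}"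
    using outer by auto
  hence "(\<Sum>y\<in>?B. if y < p \<and> r < i then 1 else 0) = (if r < i then real i else 0)"
        "(\<Sum>y\<in>?B. if q < y \<and> i + 1 < r then 1 else 0) = (if i + 1 < r then real r else 0)"
    using assms(1) by (auto simp: i_def r_def simp flip: sum.inter_filter)
  thus ?thesis
    using card_B unfolding i_def[symmetric] r_def[symmetric]
    by (simp add: cost sum_subtractf savings_def)
qed

section \<open>The savings summed over all pivot pairs\<close>

definition total_savings :: "nat \<Rightarrow> real" where
  "total_savings n = (\<Sum>j<n. \<Sum>i<j. real (savings i (n - Suc j)))"

lemma sum_lessThan_add:
  fixes f :: "nat \<Rightarrow> real"
  shows "(\<Sum>i<m + k. f i) = (\<Sum>i<m. f i) + (\<Sum>i<k. f (m + i))"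
  by (induction k) auto

text \<open>Grouped by \<open>r\<close>, the triangle of pairs \<open>(i, r)\<close> gains the
  diagonal \<open>i + r = n - 1\<close>, which consists of the pivot pairs without medium
  elements.\<close>

lemma total_savings_Suc:
  "total_savings (Suc n) = total_savings n + (\<Sum>r<n. real (savings (n - Suc r) r))"
proof -
  have eq: "total_savings n = (\<Sum>r<n. \<Sum>i<n - Suc r. real (savings i r))" for n
    unfolding total_savings_def
    by (subst sum.nat_diff_reindex[symmetric]) (auto intro!: sum.cong)
  have "total_savings (Suc n) = (\<Sum>r<n. \<Sum>i<Suc (n - Suc r). real (savings i r))"
    unfolding eq by (simp add: Suc_diff_Suc)
  thus ?thesis by (simp add: eq sum.distrib)
qed

text \<open>On the diagonal, the terms with \<open>r < i\<close> come first and save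
  \<open>i\<close>; the last terms save \<open>r\<close>. Between them stands one term,
  \<open>r = i\<close> for even and \<open>r = i + 1\<close> for odd diagonals, that saves
  nothing.\<close>

lemma savings_diagonal:
  "(\<Sum>r<2*e+1. real (savings (2*e - r) r)) = real e * (3 * real e + 1)"
  "(\<Sum>r<2*e+2. real (savings (2*e+1 - r) r)) = (real e + 1) * (3 * real e + 1)"
proof -
  have 1: "(\<Sum>r<k. c - real r) = real k * c - real k * (real k - 1) / 2" for c k
    by (induction k) (auto simp: field_simps)
  have 2: "(\<Sum>r<k. c + real r) = real k * c + real k * (real k - 1) / 2" for c k
    by (induction k) (auto simp: field_simps)
  have "(\<Sum>r<2*e+1. real (savings (2*e - r) r)) =
    (\<Sum>r<e. real (savings (2*e - r) r)) + (\<Sum>i<e+1. real (savings (2*e - (e + i)) (e + i)))"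
    using sum_lessThan_add[of "\<lambda>r. real (savings (2*e - r) r)" e "e+1"] by (simp add: mult_2)
  also have "(\<Sum>r<e. real (savings (2*e - r) r)) = (\<Sum>r<e. 2 * real e - real r)"
    by (intro sum.cong) (auto simp: savings_def of_nat_diff)
  also have "(\<Sum>i<e+1. real (savings (2*e - (e + i)) (e + i))) = (\<Sum>i<e. real e + 1 + real i)"
    by (subst Suc_eq_plus1[symmetric], subst sum.lessThan_Suc_shift)
       (auto simp: savings_def intro!: sum.cong)
  finally show "(\<Sum>r<2*e+1. real (savings (2*e - r) r)) = real e * (3 * real e + 1)"
    by (simp only: 1 2) (simp add: field_simps)
  have "(\<Sum>r<2*e+2. real (savings (2*e+1 - r) r)) =
    (\<Sum>r<e+1. real (savings (2*e+1 - r) r)) + (\<Sum>i<e+1. real (savings (2*e+1 - (e + 1 + i)) (e + 1 + i)))"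
    using sum_lessThan_add[of "\<lambda>r. real (savings (2*e+1 - r) r)" "e+1" "e+1"] by (simp add: mult_2)
  also have "(\<Sum>r<e+1. real (savings (2*e+1 - r) r)) = (\<Sum>r<e+1. 2 * real e + 1 - real r)"
    by (intro sum.cong) (auto simp: savings_def of_nat_diff)
  also have "(\<Sum>i<e+1. real (savings (2*e+1 - (e + 1 + i)) (e + 1 + i))) = (\<Sum>i<e. real e + 2 + real i)"
    by (subst Suc_eq_plus1[symmetric], subst sum.lessThan_Suc_shift)
       (auto simp: savings_def intro!: sum.cong)
  finally show "(\<Sum>r<2*e+2. real (savings (2*e+1 - r) r)) = (real e + 1) * (3 * real e + 1)"
    by (simp only: 1 2) (simp add: field_simps)
qed

text \<open>The diagonals depend on parity, hence two formulas; they are proved together because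
  each size builds on the previous one, of the other parity.\<close>

lemma total_savings_closed:
  "total_savings (2*e+2) = real e * (real e + 1) * (4 * real e + 1) / 2 \<and>
   total_savings (2*e+3) = (real e + 1) * (4 * (real e)\<^sup>2 + 7 * real e + 2) / 2"
proof (induction e)
  case 0
  show ?case by (simp add: total_savings_def savings_def numeral_eq_Suc)
next
  case (Suc e)
  have "total_savings (2 * Suc e + 2) = total_savings (2*e+3) + (\<Sum>r<2*Suc e+1. real (savings (2*Suc e - r) r))"
    using total_savings_Suc[of "2*e+3"] by (simp add: numeral_eq_Suc)
  moreover have "total_savings (2 * Suc e + 3) = total_savings (2 * Suc e + 2) + (\<Sum>r<2*Suc e+2. real (savings (2*Suc e + 1 - r) r))"
    using total_savings_Suc[of "2*Suc e+2"] by (simp add: numeral_eq_Suc)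
  ultimately show ?case
    using Suc.IH unfolding savings_diagonal by (simp add: field_simps power2_eq_square)
qed

section \<open>The expected partitioning cost\<close>

text \<open>
  This solves the recurrence of \<open>part_cost_Suc\<close>, whose increment is
  \<open>3/2 + 1/(4 n)\<close> for odd \<open>n\<close> and \<open>3/2 + (1/(n - 1) + 1/(n + 1))/8\<close> for even \<open>n\<close>. The difference
  of the harmonic sums is twice the sum of \<open>1/m\<close> over the odd \<open>m \<le> n\<close>. The comparison
  between the pivots is not included.
\<close>

definition part_cost :: "nat \<Rightarrow> real" where
  "part_cost n = 3/2 * real n - 27/8 + (harm n - alt_harm n) / 4
     - (if even n then 1 / (8 * (real n - 1)) else 3 / (8 * real n))"

lemma alt_harm_Suc: "alt_harm (Suc n) = alt_harm n + (-1) ^ Suc n / real (Suc n)"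
  by (simp add: alt_harm_def)

text \<open>A further element costs 2 less the chance of a saved comparison: among
  \<open>n + 1\<close> elements there are \<open>(n + 1) * n\<close> ordered pivot pairs,
  \<open>total_savings\<close> counts each unordered pair once, and each of the other
  \<open>n - 1\<close> elements is equally likely to come last.\<close>

lemma part_cost_Suc:
  assumes "n \<ge> 2"
  shows "part_cost (Suc n) = part_cost n + 2 -
           2 * total_savings (Suc n) / (real (n + 1) * real n * (real n - 1))"
proof (cases "even n")
  case True
  then obtain k where k: "n = 2 * k" by blast
  then obtain e where e: "k = Suc e" using assms by (cases k) auto
  have n: "n = 2 * e + 2" using k e by simp
  have "total_savings (Suc n) = (real e + 1) * (4 * (real e)\<^sup>2 + 7 * real e + 2) / 2"
    using total_savings_closed[of e] by (simp add: n numeral_eq_Suc)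
  moreover have "real n = 2 * real e + 2" "real (Suc n) = 2 * real e + 3" by (simp_all add: n)
  moreover have "2 * real e + 2 \<noteq> 0" "2 * real e + 3 \<noteq> 0" "2 * real e + 1 \<noteq> 0" "1 + 2 * real e \<noteq> 0" "3 + 2 * real e \<noteq> 0"
    by linarith+
  ultimately show ?thesis
    using True unfolding part_cost_def harm_Suc alt_harm_Suc
    by (simp add: divide_simps) (simp add: algebra_simps power2_eq_square)
next
  case False
  then obtain e where n: "n = 2 * e + 1" using oddE by blast
  have e: "e > 0" using assms n by simp
  have savings: "total_savings (Suc n) = real e * (real e + 1) * (4 * real e + 1) / 2"
    using total_savings_closed[of e] by (simp add: n)
  \<comment> \<open>The factors \<open>e\<close> and \<open>e + 1\<close> cancel against
    \<open>n - 1 = 2 * e\<close> and \<open>n + 1 = 2 * (e + 1)\<close>, leaving \<open>n\<close> as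
    the only pole.\<close>
  have quotient: "2 * total_savings (Suc n) / (real (n + 1) * real n * (real n - 1)) =
      (4 * real e + 1) / (4 * (2 * real e + 1))"
    unfolding savings using e by (simp add: n divide_simps) (simp add: algebra_simps)
  have "real n = 2 * real e + 1" "real (Suc n) = 2 * real e + 2" by (simp_all add: n)
  moreover have "2 * real e + 2 \<noteq> 0" "2 * real e + 1 \<noteq> 0" "1 + 2 * real e \<noteq> 0" by linarith+
  ultimately show ?thesis
    using False unfolding quotient part_cost_def harm_Suc alt_harm_Suc
    by (simp add: divide_simps) (simp add: algebra_simps)
qed

lemma part_cost_2: "part_cost 2 = 0"
  by (simp add: part_cost_def harm_def alt_harm_def numeral_eq_Suc)

lemma card_Diff_two:
  assumes "finite A" "a \<in> A" "b \<in> A - {a}"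
  shows "card (A - {a} - {b}) = card A - 2"
  using assms by (simp add: card_Diff_singleton_if)

text \<open>Once the last element \<open>y\<close> is fixed, all \<open>fact (card B - 1)\<close>
  orders of the others pay the same for \<open>y\<close>.\<close>

lemma sum_classify_snoc:
  fixes p q :: "'a::linorder"
  assumes "finite B"
  shows "(\<Sum>ys\<in>permutations_of_set B. real (classify_comparisons p q 0 0 ys)) =
    (\<Sum>y\<in>B. \<Sum>ys\<in>permutations_of_set (B - {y}). real (classify_comparisons p q 0 0 ys)) +
    fact (card B - 1) * (\<Sum>y\<in>B. real (last_cost (B - {y}) p q y))"
proof (cases "B = {}")
  case False
  have "(\<Sum>ys\<in>permutations_of_set (B - {y}). real (classify_comparisons p q 0 0 (ys @ [y]))) =
     (\<Sum>ys\<in>permutations_of_set (B - {y}). real (classify_comparisons p q 0 0 ys)) +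
     fact (card B - 1) * real (last_cost (B - {y}) p q y)" if "y \<in> B" for y
  proof -
    have "(\<Sum>ys\<in>permutations_of_set (B - {y}). real (classify_comparisons p q 0 0 (ys @ [y]))) =
      (\<Sum>ys\<in>permutations_of_set (B - {y}). real (classify_comparisons p q 0 0 ys) + real (last_cost (B - {y}) p q y))"
    proof (intro sum.cong refl)
      fix ys assume "ys \<in> permutations_of_set (B - {y})"
      note * = length_filter_permutation[OF this]
      show "real (classify_comparisons p q 0 0 (ys @ [y])) =
          real (classify_comparisons p q 0 0 ys) + real (last_cost (B - {y}) p q y)"
        unfolding classify_comparisons_snoc last_cost_def * by simp
    qed
    thus ?thesis using assms that by (simp add: sum.distrib)
  qed
  thus ?thesis
    by (simp add: sum_permutations_of_set_snoc[OF assms False] sum.distrib sum_distrib_left)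
qed simp

text \<open>The triples \<open>a\<close>, \<open>b\<close>, \<open>ys\<close> are exactly the inputs
  \<open>a # ys @ [b]\<close>, hence the factor \<open>fact (card A)\<close>. Deleting the element
  \<open>y\<close> classified last leaves the same kind of sum for \<open>A - {y}\<close>, which
  drives the induction.\<close>

lemma sum_classify:
  fixes A :: "'a::linorder set"
  assumes "finite A" "card A \<ge> 2"
  shows "(\<Sum>a\<in>A. \<Sum>b\<in>A - {a}. \<Sum>ys\<in>permutations_of_set (A - {a} - {b}).
            real (classify_comparisons (min a b) (max a b) 0 0 ys)) =
         fact (card A) * part_cost (card A)"
  using assms(2,1)
proof (induction "card A" arbitrary: A rule: nat_induct_at_least)
  case base
  have "A - {a} - {b} = {}" if "a \<in> A" "b \<in> A - {a}" for a b
    using card_Diff_two[OF base(2) that] base by (simp add: card_eq_0_iff)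
  hence "(\<Sum>a\<in>A. \<Sum>b\<in>A - {a}. \<Sum>ys\<in>permutations_of_set (A - {a} - {b}).
            real (classify_comparisons (min a b) (max a b) 0 0 ys)) = 0"
    by (intro sum.neutral ballI) (simp only: permutations_of_set_empty, simp)
  thus ?case using base by (simp add: part_cost_2 flip: base(1))
next
  case (Suc n)
  let ?C = "\<lambda>a b ys. real (classify_comparisons (min a b) (max a b) 0 0 ys)"
  have fin: "finite A" and cA: "card A = Suc n" using Suc by auto
  have "(\<Sum>a\<in>A. \<Sum>b\<in>A - {a}. \<Sum>ys\<in>permutations_of_set (A - {a} - {b}). ?C a b ys) =
    (\<Sum>a\<in>A. \<Sum>b\<in>A - {a}. (\<Sum>y\<in>A - {a} - {b}. \<Sum>ys\<in>permutations_of_set (A - {a} - {b} - {y}). ?C a b ys)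
      + fact (n - 2) * (2 * (real n - 1) - real (savings (card {x\<in>A. x < min a b}) (card {x\<in>A. max a b < x}))))"
  proof (intro sum.cong refl)
    fix a b assume ab: "a \<in> A" "b \<in> A - {a}"
    have *: "card (A - {a} - {b}) - 1 = n - 2"
      using card_Diff_two[OF fin ab] cA by simp
    have **: "(\<Sum>y\<in>A - {a} - {b}. real (last_cost (A - {a} - {b} - {y}) (min a b) (max a b) y)) =
      2 * (real n - 1) - real (savings (card {x\<in>A. x < min a b}) (card {x\<in>A. max a b < x}))"
      using sum_last_cost[OF fin ab(1), of b] ab cA by auto
    show "(\<Sum>ys\<in>permutations_of_set (A - {a} - {b}). ?C a b ys) =
      (\<Sum>y\<in>A - {a} - {b}. \<Sum>ys\<in>permutations_of_set (A - {a} - {b} - {y}). ?C a b ys)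
      + fact (n - 2) * (2 * (real n - 1) - real (savings (card {x\<in>A. x < min a b}) (card {x\<in>A. max a b < x})))"
      using sum_classify_snoc[of "A - {a} - {b}" "min a b" "max a b"] fin unfolding * ** by simp
  qed
  also have "\<dots> = (\<Sum>a\<in>A. \<Sum>b\<in>A - {a}. \<Sum>y\<in>A - {a} - {b}. \<Sum>ys\<in>permutations_of_set (A - {a} - {b} - {y}). ?C a b ys)
     + fact (n - 2) * (\<Sum>a\<in>A. \<Sum>b\<in>A - {a}. 2 * (real n - 1) - real (savings (card {x\<in>A. x < min a b}) (card {x\<in>A. max a b < x})))"
    by (simp only: sum.distrib sum_distrib_left)
  also have "(\<Sum>a\<in>A. \<Sum>b\<in>A - {a}. 2 * (real n - 1) - real (savings (card {x\<in>A. x < min a b}) (card {x\<in>A. max a b < x})))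
     = 2 * (\<Sum>j<Suc n. \<Sum>i<j. 2 * (real n - 1) - real (savings i (Suc n - Suc j)))"
    using sum_rank_pairs[OF fin, of "\<lambda>i _ r. 2 * (real n - 1) - real (savings i r)"] cA by simp
  also have "\<dots> = 2 * (real (Suc n) * real n * (real n - 1) - total_savings (Suc n))"
  proof -
    have "(\<Sum>j<m. real j * c) = real m * (real m - 1) / 2 * c" for m c
      by (induction m) (auto simp: field_simps)
    from this[of "2 * (real n - 1)" "Suc n"] show ?thesis
      by (simp only: total_savings_def sum_subtractf sum_constant card_lessThan) (simp add: field_simps)
  qed
  \<comment> \<open>Two swaps bring \<open>y\<close> outermost, so that the inner sums match the
    induction hypothesis for \<open>A - {y}\<close>.\<close>
  also have "(\<Sum>a\<in>A. \<Sum>b\<in>A - {a}. \<Sum>y\<in>A - {a} - {b}. \<Sum>ys\<in>permutations_of_set (A - {a} - {b} - {y}). ?C a b ys)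
    = (\<Sum>a\<in>A. \<Sum>y\<in>A - {a}. \<Sum>b\<in>A - {a} - {y}. \<Sum>ys\<in>permutations_of_set (A - {a} - {b} - {y}). ?C a b ys)"
    using fin by (intro sum.cong refl sum_off_diagonal_swap) simp
  also have "\<dots> = (\<Sum>y\<in>A. \<Sum>a\<in>A - {y}. \<Sum>b\<in>A - {a} - {y}. \<Sum>ys\<in>permutations_of_set (A - {a} - {b} - {y}). ?C a b ys)"
    by (rule sum_off_diagonal_swap[OF fin])
  also have "\<dots> = (\<Sum>y\<in>A. fact n * part_cost n)"
  proof (intro sum.cong refl)
    fix y assume y: "y \<in> A"
    have "A - {a} - {y} = A - {y} - {a}" "A - {a} - {b} - {y} = A - {y} - {a} - {b}" for a b
      by auto
    moreover have "n = card (A - {y})" "finite (A - {y})" using y cA fin by auto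
    ultimately show "(\<Sum>a\<in>A - {y}. \<Sum>b\<in>A - {a} - {y}. \<Sum>ys\<in>permutations_of_set (A - {a} - {b} - {y}). ?C a b ys)
        = fact n * part_cost n"
      using Suc(2)[of "A - {y}"] by simp
  qed
  finally have eq: "(\<Sum>a\<in>A. \<Sum>b\<in>A - {a}. \<Sum>ys\<in>permutations_of_set (A - {a} - {b}). ?C a b ys) =
     real (Suc n) * (fact n * part_cost n) + fact (n - 2) * (2 * (real (Suc n) * real n * (real n - 1) - total_savings (Suc n)))"
    using cA by simp
  obtain m where m: "n = Suc (Suc m)" using Suc(1) by (metis add_2_eq_Suc le_Suc_ex)
  \<comment> \<open>\<open>P\<close> is the quotient of \<open>fact (n + 1)\<close> by
    \<open>fact (n - 2)\<close> and the denominator in \<open>part_cost_Suc\<close>.\<close>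
  define P where "P = real (n + 1) * real n * (real n - 1)"
  have P: "P \<noteq> 0" using m by (simp add: P_def)
  have fact: "real (Suc n) * fact n = P * fact (n - 2)"
    by (simp add: m P_def algebra_simps)
  have "real (Suc n) * (fact n * part_cost n) + fact (n - 2) * (2 * (P - total_savings (Suc n))) =
      P * fact (n - 2) * part_cost n + fact (n - 2) * (2 * (P - total_savings (Suc n)))"
    by (simp only: mult.assoc[symmetric] fact)
  also have "\<dots> = P * fact (n - 2) * (part_cost n + 2 - 2 * total_savings (Suc n) / P)"
    using P by (simp add: field_simps)
  also have "\<dots> = fact (Suc n) * part_cost (Suc n)"
    unfolding part_cost_Suc[OF Suc(1)] P_def[symmetric] by (simp only: fact_Suc fact)
  finally show ?case
    unfolding eq cA by (simp only: P_def Suc_eq_plus1)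
qed

section \<open>The recurrence for the expected total cost\<close>

text \<open>The 1 is the comparison between the pivots. Each of the three sublists has size
  \<open>k\<close> with probability \<open>2 * (n - 1 - k) / (n * (n - 1))\<close>, whence the
  6.\<close>

fun count_cost :: "nat \<Rightarrow> real" where
  "count_cost n = (if n < 2 then 0 else 1 + part_cost n +
     6 / (real n * (real n - 1)) * (\<Sum>k<n - 1. (real n - 1 - real k) * count_cost k))"

declare count_cost.simps [simp del]

lemma expectation_count_comparisons:
  fixes A :: "'a::linorder set"
  assumes "finite A"
  shows "measure_pmf.expectation (pmf_of_set (permutations_of_set A)) (\<lambda>xs. real (count_comparisons xs))
         = count_cost (card A)"
  using assms
proof (induction "card A" arbitrary: A rule: less_induct)
  case less
  note fin = \<open>finite A\<close>
  define n where "n = card A"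
  show ?case
  proof (cases "n < 2")
    case True
    have "count_comparisons xs = 0" if "xs \<in> permutations_of_set A" for xs
      using length_finite_permutations_of_set[OF that] True
      by (subst count_comparisons.simps) (simp add: n_def)
    thus ?thesis using True fin
      by (simp add: expectation_permutations_of_set count_cost.simps n_def)
  next
    case False
    let ?C = "\<lambda>a b ys. real (classify_comparisons (min a b) (max a b) 0 0 ys)"
    let ?s = "\<lambda>a b. card {x\<in>A. x < min a b}" and ?l = "\<lambda>a b. card {x\<in>A. max a b < x}"
      and ?m = "\<lambda>a b. card {x\<in>A. min a b < x \<and> x < max a b}"
    let ?E = "\<lambda>a b. count_cost (?s a b) + count_cost (?m a b) + count_cost (?l a b)"
    have fin': "finite {x\<in>A. P x}" for P using fin by simp
    have "(\<Sum>xs\<in>permutations_of_set A. real (count_comparisons xs)) =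
       (\<Sum>a\<in>A. \<Sum>xs\<in>permutations_of_set (A - {a}). real (count_comparisons (a # xs)))"
      using fin False by (intro sum_permutations_of_set_Cons) (auto simp: n_def)
    also have "\<dots> = (\<Sum>a\<in>A. \<Sum>b\<in>A - {a}. \<Sum>ys\<in>permutations_of_set (A - {a} - {b}).
        real (count_comparisons (a # ys @ [b])))"
    proof (intro sum.cong refl sum_permutations_of_set_snoc)
      fix a assume a: "a \<in> A"
      have "card (A - {a}) > 0" using a fin False by (simp add: n_def)
      thus "A - {a} \<noteq> {}" by fastforce
    qed (use fin in simp)
    also have "\<dots> = (\<Sum>a\<in>A. \<Sum>b\<in>A - {a}. (\<Sum>ys\<in>permutations_of_set (A - {a} - {b}). ?C a b ys) +
        fact (n - 2) * (1 + ?E a b))"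
    proof (intro sum.cong refl)
      fix a b assume ab: "a \<in> A" "b \<in> A - {a}"
      let ?B = "A - {a} - {b}"
      have finB: "finite ?B" and cB: "card ?B = n - 2"
        using fin card_Diff_two[OF fin ab] by (auto simp: n_def)
      \<comment> \<open>Since \<open>P\<close> rejects both pivots, it selects the same elements
        from \<open>?B\<close> as from \<open>A\<close>, and they form a proper subset, to which the
        induction hypothesis applies.\<close>
      have *: "(\<Sum>ys\<in>permutations_of_set ?B. real (count_comparisons (filter P ys))) =
            fact (n - 2) * count_cost (card {x\<in>A. P x})"
        if "\<not> P a" "\<not> P b" for P
      proof -
        have eq: "{x\<in>?B. P x} = {x\<in>A. P x}" using that by auto
        have "card {x\<in>A. P x} < card A"
          using ab that by (intro psubset_card_mono fin) auto
        from less(1)[OF this fin'] show ?thesis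
          using sum_permutations_of_set_filter[OF finB, of "\<lambda>xs. real (count_comparisons xs)" P]
          by (simp only: eq cB)
      qed
      have "count_comparisons (a # ys @ [b]) = 1 + classify_comparisons (min a b) (max a b) 0 0 ys
          + count_comparisons (filter (\<lambda>x. x < min a b) ys)
          + count_comparisons (filter (\<lambda>x. min a b < x \<and> x < max a b) ys)
          + count_comparisons (filter (\<lambda>x. max a b < x) ys)" for ys
        by (subst count_comparisons.simps) (simp add: Let_def butlast_append)
      hence "(\<Sum>ys\<in>permutations_of_set ?B. real (count_comparisons (a # ys @ [b]))) =
         fact (n - 2) + (\<Sum>ys\<in>permutations_of_set ?B. ?C a b ys)
         + (\<Sum>ys\<in>permutations_of_set ?B. real (count_comparisons (filter (\<lambda>x. x < min a b) ys)))
         + (\<Sum>ys\<in>permutations_of_set ?B. real (count_comparisons (filter (\<lambda>x. min a b < x \<and> x < max a b) ys)))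
         + (\<Sum>ys\<in>permutations_of_set ?B. real (count_comparisons (filter (\<lambda>x. max a b < x) ys)))"
        using finB by (simp add: sum.distrib cB)
      also have "(\<Sum>ys\<in>permutations_of_set ?B. real (count_comparisons (filter (\<lambda>x. x < min a b) ys)))
          = fact (n - 2) * count_cost (?s a b)"
        by (rule *) auto
      also have "(\<Sum>ys\<in>permutations_of_set ?B. real (count_comparisons (filter (\<lambda>x. min a b < x \<and> x < max a b) ys)))
          = fact (n - 2) * count_cost (?m a b)"
        by (rule *) (auto simp: min_def max_def split: if_splits)
      also have "(\<Sum>ys\<in>permutations_of_set ?B. real (count_comparisons (filter (\<lambda>x. max a b < x) ys)))
          = fact (n - 2) * count_cost (?l a b)"
        by (rule *) auto
      finally show "(\<Sum>ys\<in>permutations_of_set ?B. real (count_comparisons (a # ys @ [b]))) =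
         (\<Sum>ys\<in>permutations_of_set ?B. ?C a b ys) + fact (n - 2) * (1 + ?E a b)"
        by (simp add: algebra_simps)
    qed
    also have "\<dots> = fact n * part_cost n + fact (n - 2) * (\<Sum>a\<in>A. \<Sum>b\<in>A - {a}. 1 + ?E a b)"
    proof -
      have "(\<Sum>a\<in>A. \<Sum>b\<in>A - {a}. f a b + c * g a b) =
        (\<Sum>a\<in>A. \<Sum>b\<in>A - {a}. f a b) + c * (\<Sum>a\<in>A. \<Sum>b\<in>A - {a}. g a b)" for f g and c :: real
        by (simp add: sum.distrib sum_distrib_left)
      thus ?thesis using sum_classify[OF fin] False by (simp only: n_def not_less)
    qed
    also have "(\<Sum>a\<in>A. \<Sum>b\<in>A - {a}. 1 + ?E a b) =
        2 * (\<Sum>j<n. \<Sum>i<j. 1 + (count_cost i + count_cost (j - Suc i) + count_cost (n - Suc j)))"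
      unfolding n_def
      by (rule sum_rank_pairs[OF fin, of "\<lambda>s m l. 1 + (count_cost s + count_cost m + count_cost l)"])
    \<comment> \<open>By the triangle lemmas the three cost sums are equal; with the factor 2 they
      give the 6.\<close>
    also have "\<dots> = real n * (real n - 1) + 6 * (\<Sum>k<n. (real n - 1 - real k) * count_cost k)"
    proof -
      have ones: "(\<Sum>j<m. \<Sum>i<j. 1 :: real) = real m * (real m - 1) / 2" for m
        by (induction m) (auto simp: field_simps)
      show ?thesis
        unfolding sum.distrib ones
        by (simp only: sum_triangle_lower sum_triangle_gap sum_triangle_upper) simp
    qed
    \<comment> \<open>The term \<open>k = n - 1\<close> has weight 0.\<close>
    also have "(\<Sum>k<n. (real n - 1 - real k) * count_cost k) = (\<Sum>k<n - 1. (real n - 1 - real k) * count_cost k)"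
      using False by (cases n) auto
    finally have eq: "(\<Sum>xs\<in>permutations_of_set A. real (count_comparisons xs)) =
      fact n * part_cost n + fact (n - 2) *
        (real n * (real n - 1) + 6 * (\<Sum>k<n - 1. (real n - 1 - real k) * count_cost k))" .
    obtain m where m: "n = Suc (Suc m)" using False by (metis add_2_eq_Suc le_Suc_ex not_less)
    have f: "fact n = real n * (real n - 1) * fact (n - 2)" by (simp add: m algebra_simps)
    have "real n * (real n - 1) \<noteq> 0" using m by simp
    thus ?thesis using False
      unfolding expectation_permutations_of_set[OF fin] eq n_def[symmetric]
      by (subst count_cost.simps) (simp add: f field_simps)
  qed
qed

section \<open>Verification of the closed form\<close>

text \<open>
  Two differences remove the weighted sum in the recurrence, so that a closed form can be
  verified by pure arithmetic.
\<close>

lemma count_cost_second_difference: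
  assumes "n \<ge> 2"
  defines "D \<equiv> \<lambda>m. real m * (real m - 1) * (count_cost m - 1 - part_cost m)"
  shows "D (n + 2) - 2 * D (n + 1) + D n = 6 * count_cost n"
proof -
  have D: "D (Suc m) = 6 * (\<Sum>k<m. (real m - real k) * count_cost k)" if "m \<ge> 1" for m
    unfolding D_def using that by (subst count_cost.simps) simp
  \<comment> \<open>The first difference of the weighted sums is a plain partial sum, so the second
    difference is a single \<open>count_cost\<close> term.\<close>
  have step: "(\<Sum>k<Suc m. (real (Suc m) - real k) * count_cost k) =
     (\<Sum>k<m. (real m - real k) * count_cost k) + (\<Sum>k<Suc m. count_cost k)" for m
    by (simp add: algebra_simps sum.distrib sum_subtractf)
  obtain m where m: "n = Suc m" "m \<ge> 1" using assms(1) by (cases n) auto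
  show ?thesis
    using D[of m] D[of "Suc m"] D[of "Suc (Suc m)"] step[of m] step[of "Suc m"] m by simp
qed

definition closed_cost :: "nat \<Rightarrow> real" where
  "closed_cost n = 9/5 * real n * harm n - 1/5 * real n * alt_harm n - 89/25 * real n
         + 67/40 * harm n - 3/40 * alt_harm n - 83/800 + (-1) ^ n / 10
         - of_bool (even n) / 320 * (1 / (real n - 3) + 3 / (real n - 1))
         + of_bool (odd n) / 320 * (3 / (real n - 2) + 1 / real n)"

lemma harm_alt_harm_numerals:
  "harm 3 = (11/6 :: real)" "harm 4 = (25/12 :: real)" "harm 5 = (137/60 :: real)"
  "alt_harm 3 = - 5/6" "alt_harm 4 = - 7/12" "alt_harm 5 = - 47/60"
  by (simp_all add: harm_def alt_harm_def numeral_eq_Suc)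

lemma count_cost_numerals:
  "count_cost 0 = 0" "count_cost 1 = 0" "count_cost 2 = 1" "count_cost 3 = 8/3"
  "count_cost 4 = 19/4" "count_cost 5 = 433/60"
proof -
  show 0: "count_cost 0 = 0" and 1: "count_cost 1 = 0"
    by (simp_all add: count_cost.simps)
  have sums: "(\<Sum>k<2. f k) = f 0 + f 1" "(\<Sum>k<3. f k) = f 0 + f 1 + f 2"
    "(\<Sum>k<4. f k) = f 0 + f 1 + f 2 + f 3" for f :: "nat \<Rightarrow> real"
    by (simp_all add: eval_nat_numeral)
  show 2: "count_cost 2 = 1"
    by (subst count_cost.simps) (simp add: 0[simplified] part_cost_2)
  show 3: "count_cost 3 = 8/3"
    by (subst count_cost.simps) (simp add: sums 0 1[simplified] part_cost_def harm_alt_harm_numerals)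
  show 4: "count_cost 4 = 19/4"
    by (subst count_cost.simps) (simp add: sums 0 1[simplified] 2 part_cost_def harm_alt_harm_numerals)
  show "count_cost 5 = 433/60"
    by (subst count_cost.simps) (simp add: sums 0 1[simplified] 2 3 part_cost_def harm_alt_harm_numerals)
qed

text \<open>The harmonic sums at \<open>n + 1\<close> and \<open>n + 2\<close> are expressed by
  those at \<open>n\<close>, and every reciprocal becomes a symbol. Rules such as
  \<open>x * v = 1 - v\<close> then bring both sides to a common normal form.\<close>

lemma closed_cost_second_difference:
  assumes "n \<ge> 4"
  defines "D \<equiv> \<lambda>m. real m * (real m - 1) * (closed_cost m - 1 - part_cost m)"
  shows "D (n + 2) - 2 * D (n + 1) + D n = 6 * closed_cost n"
proof -
  define x where "x = real n"
  have x: "x \<ge> 4" using assms(1) by (simp add: x_def)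
  define h where "h = (harm n :: real)"
  define a where "a = alt_harm n"
  define v where "v = 1 / (x + 1)"
  define w where "w = 1 / (x + 2)"
  have v: "x * v = 1 - v" and w: "x * w = 1 - 2 * w"
    using x by (simp_all add: v_def w_def field_simps)
  have of_nat: "real (n + 1) = x + 1" "real (n + 2) = x + 2" "real n = x"
    by (simp_all add: x_def)
  have harm: "harm (n + 1) = h + v" "harm (n + 2) = h + v + w"
    by (simp_all add: harm_Suc h_def x_def v_def w_def field_simps)
  show ?thesis
  proof (cases "even n")
    case True
    \<comment> \<open>For even \<open>n\<close> the poles are at 3, 1, -1 and -2;
      \<open>x \<ge> 4\<close> stays clear of them.\<close>
    define t where "t = 1 / (x - 3)"
    define u where "u = 1 / (x - 1)"
    have t: "x * t = 1 + 3 * t" and u: "x * u = 1 + u"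
      using x by (simp_all add: t_def u_def field_simps)
    have alt_harm: "alt_harm (n + 1) = a - v" "alt_harm (n + 2) = a - v + w"
      using True by (simp_all add: alt_harm_Suc a_def x_def v_def w_def field_simps)
    have part: "part_cost (n + 2) = 3/2 * (x + 2) - 27/8 + ((h + v + w) - (a - v + w)) / 4 - v / 8"
      "part_cost (n + 1) = 3/2 * (x + 1) - 27/8 + ((h + v) - (a - v)) / 4 - 3 * v / 8"
      "part_cost n = 3/2 * x - 27/8 + (h - a) / 4 - u / 8"
      using True unfolding part_cost_def harm alt_harm of_nat h_def[symmetric] a_def[symmetric]
      by (simp_all add: u_def v_def)
    have closed: "closed_cost (n + 2) = 9/5 * (x + 2) * (h + v + w) - 1/5 * (x + 2) * (a - v + w)
          - 89/25 * (x + 2) + 67/40 * (h + v + w) - 3/40 * (a - v + w) - 83/800 + 1/10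
          - 1/320 * (u + 3 * v)"
      "closed_cost (n + 1) = 9/5 * (x + 1) * (h + v) - 1/5 * (x + 1) * (a - v)
          - 89/25 * (x + 1) + 67/40 * (h + v) - 3/40 * (a - v) - 83/800 - 1/10
          + 1/320 * (3 * u + v)"
      "closed_cost n = 9/5 * x * h - 1/5 * x * a - 89/25 * x + 67/40 * h - 3/40 * a - 83/800 + 1/10
          - 1/320 * (t + 3 * u)"
      using True unfolding closed_cost_def harm alt_harm of_nat h_def[symmetric] a_def[symmetric]
      by (simp_all add: t_def u_def v_def)
    \<comment> \<open>Multiplying out with these rules computes partial fractions; clearing denominators instead is infeasible.\<close>
    have poles: "x * (t * y) = y + 3 * t * y" "x * (u * y) = y + u * y"
      "x * (v * y) = y - v * y" "x * (w * y) = y - 2 * w * y" for y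
      using t u v w by (simp_all add: mult.assoc[symmetric]) (simp_all add: algebra_simps)
    \<comment> \<open>Normalisation reorders products, so each rule is also supplied with
      \<open>x\<close> as the second factor.\<close>
    note commuted = t[unfolded mult.commute[of x]] u[unfolded mult.commute[of x]]
      v[unfolded mult.commute[of x]] w[unfolded mult.commute[of x]]
      poles[unfolded mult.left_commute[of x]]
    show ?thesis
      unfolding D_def part closed of_nat
      by (simp add: algebra_simps add_divide_distrib diff_divide_distrib t u v w poles commuted)
  next
    case False
    \<comment> \<open>For odd \<open>n\<close> the poles are at 2, 0, -1 and -2.\<close>
    define t where "t = 1 / (x - 2)"
    define u where "u = 1 / x"
    have t: "x * t = 1 + 2 * t" and u: "x * u = 1"
      using x by (simp_all add: t_def u_def field_simps)
    have alt_harm: "alt_harm (n + 1) = a + v" "alt_harm (n + 2) = a + v - w"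
      using False by (simp_all add: alt_harm_Suc a_def x_def v_def w_def field_simps)
    have part: "part_cost (n + 2) = 3/2 * (x + 2) - 27/8 + ((h + v + w) - (a + v - w)) / 4 - 3 * w / 8"
      "part_cost (n + 1) = 3/2 * (x + 1) - 27/8 + ((h + v) - (a + v)) / 4 - u / 8"
      "part_cost n = 3/2 * x - 27/8 + (h - a) / 4 - 3 * u / 8"
      using False unfolding part_cost_def harm alt_harm of_nat h_def[symmetric] a_def[symmetric]
      by (simp_all add: u_def v_def w_def)
    have closed: "closed_cost (n + 2) = 9/5 * (x + 2) * (h + v + w) - 1/5 * (x + 2) * (a + v - w)
          - 89/25 * (x + 2) + 67/40 * (h + v + w) - 3/40 * (a + v - w) - 83/800 - 1/10
          + 1/320 * (3 * u + w)"
      "closed_cost (n + 1) = 9/5 * (x + 1) * (h + v) - 1/5 * (x + 1) * (a + v)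
          - 89/25 * (x + 1) + 67/40 * (h + v) - 3/40 * (a + v) - 83/800 + 1/10
          - 1/320 * (t + 3 * u)"
      "closed_cost n = 9/5 * x * h - 1/5 * x * a - 89/25 * x + 67/40 * h - 3/40 * a - 83/800 - 1/10
          + 1/320 * (3 * t + u)"
      using False unfolding closed_cost_def harm alt_harm of_nat h_def[symmetric] a_def[symmetric]
      by (simp_all add: t_def u_def v_def w_def)
    have poles: "x * (t * y) = y + 2 * t * y" "x * (u * y) = y"
      "x * (v * y) = y - v * y" "x * (w * y) = y - 2 * w * y" for y
      using t u v w by (simp_all add: mult.assoc[symmetric]) (simp_all add: algebra_simps)
    note commuted = t[unfolded mult.commute[of x]] u[unfolded mult.commute[of x]]
      v[unfolded mult.commute[of x]] w[unfolded mult.commute[of x]]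
      poles[unfolded mult.left_commute[of x]]
    show ?thesis
      unfolding D_def part closed of_nat
      by (simp add: algebra_simps add_divide_distrib diff_divide_distrib t u v w poles commuted)
  qed
qed

text \<open>The relation has order two, so the induction carries consecutive pairs, starting from
  the values at 4 and 5. The leading coefficient \<open>?c\<close> is nonzero, hence the relation
  determines the value at \<open>n + 2\<close>.\<close>

lemma count_cost_closed:
  assumes "n \<ge> 4"
  shows "count_cost n = closed_cost n"
proof -
  have "count_cost n = closed_cost n \<and> count_cost (n + 1) = closed_cost (n + 1)"
    using assms
  proof (induction n rule: nat_induct_at_least)
    case base
    show ?case
      by (simp add: count_cost_numerals closed_cost_def harm_alt_harm_numerals)
  next
    case (Suc n)
    have IH: "count_cost n = closed_cost n" "count_cost (n + 1) = closed_cost (n + 1)"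
      using Suc(2) by simp_all
    have n2: "n \<ge> 2" using Suc(1) by simp
    let ?c = "real (n + 2) * (real (n + 2) - 1)"
    have "?c * (count_cost (n + 2) - 1 - part_cost (n + 2)) =
        ?c * (closed_cost (n + 2) - 1 - part_cost (n + 2))"
      using count_cost_second_difference[OF n2, unfolded IH] closed_cost_second_difference[OF Suc(1)]
      by linarith
    moreover have "?c \<noteq> 0" using Suc(1) by simp
    ultimately have "count_cost (n + 2) - 1 - part_cost (n + 2) = closed_cost (n + 2) - 1 - part_cost (n + 2)"
      by (metis mult_left_cancel)
    thus ?case using Suc by simp
  qed
  thus ?thesis by simp
qed

theorem theorem12p1:
  fixes A :: "'a::linorder set" and n :: nat
  assumes "finite A" and "card A = n" and "n \<ge> 4"
  shows "measure_pmf.expectation (pmf_of_set (permutations_of_set A))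
           (\<lambda>xs. real (count_comparisons xs)) =
         9/5 * real n * harm n - 1/5 * real n * alt_harm n - 89/25 * real n
         + 67/40 * harm n - 3/40 * alt_harm n - 83/800 + (-1) ^ n / 10
         - of_bool (even n) / 320 * (1 / (real n - 3) + 3 / (real n - 1))
         + of_bool (odd n) / 320 * (3 / (real n - 2) + 1 / real n)"
  using expectation_count_comparisons[OF assms(1)] count_cost_closed[OF assms(3)] assms(2)
  by (simp add: closed_cost_def)

end
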